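(* Let $\gamma_1,\ldots,\gamma_4$ be closed convex curves around the vertices of a convex quadrilateral in $\mathbb{R}^2$ as in the context, and let four rays be given which meet at the generalized Fermat-Torricelli point $P$ (the $i$-th ray issuing from $P$ through the orthogonal projection $A_i'$ of $P$ onto $\gamma_i$), such that these projections form a convex quadrilateral $A_1'A_2'A_3'A_4'$. Consider, with $P$ and the rays fixed, all positive weights $(w_1,w_2,w_3,w_4)$ with fixed total sum for which $P$ is the generalized Fermat-Torricelli point. Then an increase of the weight that corresponds to one ray causes a decrease of the two weights that correspond to the two neighboring rays and an increase of the weight that corresponds to the opposite ray. That is, if $(w_i)$ and $(\tilde w_i)$ are two such systems of weights and $\tilde w_i>w_i$ for some $i$, then, indices taken modulo $4$, $\tilde w_{i\pm1}<w_{i\pm1}$ and $\tilde w_{i+2}>w_{i+2}$.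
   Context: Setting: $A_1A_2A_3A_4$ is a convex quadrilateral in $\mathbb{R}^2$. For each $i$, $\gamma_i$ is a closed convex curve surrounding $A_i$ that meets orthogonally the two sides of the quadrilateral containing $A_i$; the curves do not intersect each other inside the quadrilateral. Segments on the edges and four arcs of the $\gamma_i$ bound a curvilinear octagon $\Omega$, and $P$ lies inside $\Omega$. For positive weights $w_i$ the generalized Fermat-Torricelli point is the minimizer of $\sum_{i=1}^4 w_i\,d(P,\gamma_i)$, $d$ being Euclidean distance. $A_i'$ is the (nearest-point) projection of $P$ onto $\gamma_i$; the ray from $P$ through $A_i'$ meets $\gamma_i$ orthogonally. *)

theory Defs
  imports "HOL-Analysis.Analysis"
begin

text \<open>
  Quadruples are indexed by the numeral type \<^typ>\<open>4\<close>, whose arithmetic is modulo 4, so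
  \<open>i + 1\<close>, \<open>i - 1\<close> are the two neighbours of \<open>i\<close> and \<open>i + 2\<close> is its opposite.
\<close>

text \<open>
  The vertices are in cyclic order: each side spans a line that has the remaining two
  vertices strictly on one side. Strictness excludes degenerate quadrilaterals.
\<close>

definition convex_quadrilateral :: "(4 \<Rightarrow> real^2) \<Rightarrow> bool" where
  "convex_quadrilateral A \<longleftrightarrow>
     (\<forall>i. \<exists>n c. n \<bullet> A i = c \<and> n \<bullet> A (i + 1) = c \<and> n \<bullet> A (i + 2) < c \<and> n \<bullet> A (i + 3) < c)"

definition parametrizes_closed_curve :: "(real \<Rightarrow> real^2) \<Rightarrow> (real^2) set \<Rightarrow> bool" where
  "parametrizes_closed_curve g \<gamma> \<longleftrightarrow>
     simple_path g \<and> pathfinish g = pathstart g \<and> path_image g = \<gamma>"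

definition closed_convex_curve :: "(real^2) set \<Rightarrow> bool" where
  "closed_convex_curve \<gamma> \<longleftrightarrow> (\<exists>g. parametrizes_closed_curve g \<gamma>) \<and> convex (inside \<gamma>)"

text \<open>
  The parameter \<open>t\<close> is interior, so the derivative is two-sided; since \<open>v\<close> is nonzero,
  a curve has no tangent vector at a corner. The choice of the parametrization is free,
  so every point of the curve can be moved away from the base point.
\<close>

definition tangent_vector :: "(real^2) set \<Rightarrow> real^2 \<Rightarrow> real^2 \<Rightarrow> bool" where
  "tangent_vector \<gamma> Q v \<longleftrightarrow>
     v \<noteq> 0 \<and>
     (\<exists>g t. parametrizes_closed_curve g \<gamma> \<and> 0 < t \<and> t < 1 \<and> g t = Q \<and>
            (g has_vector_derivative v) (at t))"

definition meets_segment_orthogonally :: "(real^2) set \<Rightarrow> real^2 \<Rightarrow> real^2 \<Rightarrow> bool" where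
  "meets_segment_orthogonally \<gamma> a b \<longleftrightarrow>
     \<gamma> \<inter> closed_segment a b \<noteq> {} \<and>
     (\<forall>Q \<in> \<gamma> \<inter> closed_segment a b. \<exists>v. tangent_vector \<gamma> Q v \<and> v \<bullet> (b - a) = 0)"

text \<open>
  The closed region left of the quadrilateral after the parts enclosed by the curves are cut
  off at the corners. Under the three conditions of \<open>cuts_corners\<close> its boundary consists of one
  segment on each edge and one arc of each curve: the last two conditions keep each curve away
  from the two edges not containing its vertex, and from the other curves, within the closed
  quadrilateral.
\<close>

definition octagon :: "(4 \<Rightarrow> real^2) \<Rightarrow> (4 \<Rightarrow> (real^2) set) \<Rightarrow> (real^2) set" where
  "octagon A \<gamma> = convex hull (range A) - (\<Union>i. inside (\<gamma> i))"

definition cuts_corners :: "(4 \<Rightarrow> real^2) \<Rightarrow> (4 \<Rightarrow> (real^2) set) \<Rightarrow> bool" where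
  "cuts_corners A \<gamma> \<longleftrightarrow>
     (\<forall>i. meets_segment_orthogonally (\<gamma> i) (A i) (A (i + 1)) \<and>
          meets_segment_orthogonally (\<gamma> i) (A i) (A (i - 1))) \<and>
     (\<forall>i. \<gamma> i \<inter> closed_segment (A (i + 1)) (A (i + 2)) = {} \<and>
          \<gamma> i \<inter> closed_segment (A (i + 2)) (A (i + 3)) = {}) \<and>
     (\<forall>i j. i \<noteq> j \<longrightarrow> \<gamma> i \<inter> \<gamma> j \<inter> convex hull (range A) = {})"

text \<open>
  Minimality is only required among the points of the octagon, and the minimizer need not be
  unique (it may fail to be when the curves contain line segments).
\<close>

definition fermat_torricelli_point ::
    "(4 \<Rightarrow> real^2) \<Rightarrow> (4 \<Rightarrow> (real^2) set) \<Rightarrow> (4 \<Rightarrow> real) \<Rightarrow> real^2 \<Rightarrow> bool" where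
  "fermat_torricelli_point A \<gamma> w P \<longleftrightarrow>
     is_arg_min (\<lambda>X. \<Sum>i\<in>UNIV. w i * infdist X (\<gamma> i)) (\<lambda>X. X \<in> octagon A \<gamma>) P"

end

theory Submission
  imports Defs
begin

text \<open>
  Replacing each curve by the projection \<open>A'\<^sub>i\<close> of \<open>P\<close> can only enlarge the objective function and
  does not change its value at \<open>P\<close>, so \<open>P\<close> also minimizes \<open>\<Sum>i. w\<^sub>i * dist X A'\<^sub>i\<close> locally. Hence
  \<open>\<Sum>i. w\<^sub>i *\<^sub>R u\<^sub>i = 0\<close> for the unit vectors \<open>u\<^sub>i\<close> along the rays. The difference of two such systems of
  weights with equal sums is an affine dependence of the four points \<open>u\<^sub>i\<close> of the unit circle.
  These are in the cyclic order of the \<open>A'\<^sub>i\<close>, thus in strictly convex position, and the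
  coefficients of the dependence alternate in sign.
\<close>

section \<open>Cross products and orientation in the plane\<close>

definition cross2 :: "real^2 \<Rightarrow> real^2 \<Rightarrow> real" where
  "cross2 x y = x $ 1 * y $ 2 - x $ 2 * y $ 1"

lemma inner_vec2: "x \<bullet> y = x $ 1 * y $ 1 + x $ 2 * y $ 2" for x y :: "real^2"
  by (simp add: inner_vec_def sum_2)

lemma cross2_scaleR: "cross2 (a *\<^sub>R x) (b *\<^sub>R y) = a * b * cross2 x y"
  by (simp add: cross2_def algebra_simps)

text \<open>Cramer's rule: it gives the linear relation between three plane vectors, here paired
  with \<open>n\<close>.\<close>

lemma inner_cross2_cyclic:
  "(n \<bullet> x) * cross2 y z + (n \<bullet> y) * cross2 z x + (n \<bullet> z) * cross2 x y = 0"
  by (simp add: cross2_def inner_vec2 algebra_simps)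

lemma cross2_nonzero_on_line:
  assumes "n \<bullet> x = h" "n \<bullet> y = h" "h \<noteq> 0" "x \<noteq> y"
  shows "cross2 x y \<noteq> 0"
proof
  assume c: "cross2 x y = 0"
  \<comment> \<open>With both inner products equal to \<open>h\<close>, the left-hand sides are the
    coordinates of \<open>h *\<^sub>R (y - x)\<close>.\<close>
  have "(n \<bullet> x) * (y $ 1) - (n \<bullet> y) * (x $ 1) = - n $ 2 * cross2 x y"
    and "(n \<bullet> x) * (y $ 2) - (n \<bullet> y) * (x $ 2) = n $ 1 * cross2 x y"
    by (simp_all add: cross2_def inner_vec2 algebra_simps)
  then have "y $ 1 = x $ 1 \<and> y $ 2 = x $ 2"
    using assms c by simp
  then show False
    using \<open>x \<noteq> y\<close> by (simp add: vec_eq_iff forall_2)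
qed

text \<open>Both signs equal the orientation of the triangle \<open>x y z\<close>.\<close>

lemma cross2_consecutive_same_sign:
  assumes xy: "n \<bullet> x = h" "n \<bullet> y = h" "n \<bullet> z < h" "0 < h"
    and yz: "m \<bullet> y = k" "m \<bullet> z = k" "m \<bullet> x < k" "0 < k"
  shows "0 < cross2 x y * cross2 y z"
proof -
  \<comment> \<open>Twice the signed area of the triangle \<open>x y z\<close>.\<close>
  define D where "D = cross2 x y + cross2 y z + cross2 z x"
  have "x \<noteq> y"
    using yz by auto
  then have nz: "cross2 x y \<noteq> 0"
    using cross2_nonzero_on_line[OF xy(1,2)] xy(4) by simp
  have 1: "h * D = (h - n \<bullet> z) * cross2 x y"
    using inner_cross2_cyclic[of n x y z] xy by (simp add: D_def algebra_simps)
  have 2: "k * D = (k - m \<bullet> x) * cross2 y z"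
    using inner_cross2_cyclic[of m x y z] yz by (simp add: D_def algebra_simps)
  have "D \<noteq> 0"
    using 1 nz xy by auto
  have "(h - n \<bullet> z) * (k - m \<bullet> x) * (cross2 x y * cross2 y z) = (h * D) * (k * D)"
    unfolding 1 2 by (simp add: algebra_simps)
  also have "\<dots> = h * k * D\<^sup>2"
    by (simp add: power2_eq_square)
  also have "\<dots> > 0"
    using xy yz \<open>D \<noteq> 0\<close> by simp
  finally have "0 < (h - n \<bullet> z) * (k - m \<bullet> x) * (cross2 x y * cross2 y z)" .
  moreover have "0 < (h - n \<bullet> z) * (k - m \<bullet> x)"
    using xy yz by simp
  ultimately show ?thesis
    using zero_less_mult_pos by blast
qed

lemma inner_less_one_of_cross2:
  assumes "norm u = 1" "norm v = 1" "cross2 u v \<noteq> 0"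
  shows "u \<bullet> v < 1"
proof -
  have "(u \<bullet> v)\<^sup>2 + (cross2 u v)\<^sup>2 = (u \<bullet> u) * (v \<bullet> v)"
    by (simp add: cross2_def inner_vec2 power2_eq_square algebra_simps)
  also have "\<dots> = 1"
    using assms by (simp add: dot_square_norm)
  finally have "(u \<bullet> v)\<^sup>2 < 1"
    using assms(3) by (smt (verit) zero_less_power2)
  then show ?thesis
    by (smt (verit) one_power2 power_mono)
qed

text \<open>
  In terms of the angles \<open>a\<close>, \<open>b\<close> from \<open>u\<close> to \<open>v\<close> and from \<open>v\<close> to \<open>z\<close> this says that
  \<open>sin a + sin b - sin (a + b) = sin a * (1 - cos b) + sin b * (1 - cos a)\<close> is positive. The factor
  \<open>s\<close> covers both orientations.
\<close>

lemma unit_triangle_orientation: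
  assumes unit: "norm u = 1" "norm v = 1" "norm z = 1"
    and s: "0 < s * cross2 u v" "0 < s * cross2 v z"
  shows "0 < s * (cross2 u v + cross2 v z + cross2 z u)"
proof -
  \<comment> \<open>For unit \<open>v\<close> this is the addition formula for the sine, since
    \<open>cross2 z u\<close> is \<open>- sin (a + b)\<close>.\<close>
  have "cross2 z u * (v \<bullet> v) = - (cross2 u v * (v \<bullet> z)) - cross2 v z * (u \<bullet> v)"
    by (simp add: cross2_def inner_vec2 algebra_simps)
  then have zu: "cross2 z u = - (cross2 u v * (v \<bullet> z)) - cross2 v z * (u \<bullet> v)"
    using unit by (simp add: dot_square_norm)
  have eq: "s * (cross2 u v + cross2 v z + cross2 z u)
      = s * cross2 u v * (1 - v \<bullet> z) + s * cross2 v z * (1 - u \<bullet> v)"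
    unfolding zu by (simp add: algebra_simps)
  have "u \<bullet> v < 1" "v \<bullet> z < 1"
    using unit s by (auto intro!: inner_less_one_of_cross2)
  then show ?thesis
    unfolding eq using s by (intro add_pos_pos mult_pos_pos[of "s * _"]) auto
qed

section \<open>Affine dependences of four points of the unit circle\<close>

lemma sum_cyclic_4: "(\<Sum>j\<in>UNIV. f j) = f i + f (i + 1) + f (i + 2) + f (i + 3)"
  for i :: 4 and f :: "4 \<Rightarrow> 'a::comm_monoid_add"
proof -
  have mod4: "(5::4) = 1" "(6::4) = 2" "(7::4) = 3"
    by simp_all
  show ?thesis
    using exhaust_4[of i] by (elim disjE) (simp_all add: sum_4 mod4 add_ac)
qed

lemma affine_dependence_neighbour_sign:
  fixes u :: "4 \<Rightarrow> real^2" and d :: "4 \<Rightarrow> real" and i :: 4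
  assumes unit: "\<And>j. norm (u j) = 1"
    and s: "\<And>j. 0 < s * cross2 (u j) (u (j + 1))"
    and sum0: "(\<Sum>j\<in>UNIV. d j) = 0" and comb0: "(\<Sum>j\<in>UNIV. d j *\<^sub>R u j) = 0"
  shows "0 < d i \<Longrightarrow> d (i + 3) < 0" and "d i < 0 \<Longrightarrow> 0 < d (i + 3)"
proof -
  \<comment> \<open>Up to the factor \<open>s\<close>, twice the signed area of the triangle
    \<open>x\<close>, \<open>u (i+1)\<close>, \<open>u (i+2)\<close>: an affine function that
    vanishes on the line through the last two points. Applied to the dependence, it leaves only the
    terms of \<open>i\<close> and \<open>i + 3\<close>.\<close>
  define F where "F x = s * (cross2 x (u (i+1)) + cross2 (u (i+1)) (u (i+2)) + cross2 (u (i+2)) x)"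
    for x
  have s1: "0 < s * cross2 (u i) (u (i+1))" "0 < s * cross2 (u (i+1)) (u (i+2))"
      "0 < s * cross2 (u (i+2)) (u (i+3))"
    using s[of i] s[of "i+1"] s[of "i+2"] by (simp_all add: add.assoc)
  have F0: "F (u i) > 0"
    unfolding F_def using s1 by (intro unit_triangle_orientation unit)
  have F3: "F (u (i+3)) > 0"
    using unit_triangle_orientation[OF unit unit unit s1(2,3)] by (simp add: F_def algebra_simps)
  have F12: "F (u (i+1)) = 0" "F (u (i+2)) = 0"
    by (simp_all add: F_def cross2_def)
  have comb: "(\<Sum>j\<in>UNIV. d j * u j $ k) = 0" for k
    using arg_cong[OF comb0, of "\<lambda>v. v $ k"] by simp
  define a where "a = s * (u (i+1) $ 2 - u (i+2) $ 2)"
  define b where "b = s * (u (i+2) $ 1 - u (i+1) $ 1)"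
  define c where "c = s * cross2 (u (i+1)) (u (i+2))"
  have F_affine: "F x = a * x $ 1 + b * x $ 2 + c" for x
    by (simp add: F_def a_def b_def c_def cross2_def algebra_simps)
  have "(\<Sum>j\<in>UNIV. d j * F (u j)) =
      a * (\<Sum>j\<in>UNIV. d j * u j $ 1) + b * (\<Sum>j\<in>UNIV. d j * u j $ 2) + c * (\<Sum>j\<in>UNIV. d j)"
    unfolding F_affine sum_distrib_left sum.distrib[symmetric]
    by (intro sum.cong refl) (simp add: algebra_simps)
  then have "(\<Sum>j\<in>UNIV. d j * F (u j)) = 0"
    by (simp only: comb sum0)
  then have bal: "d i * F (u i) + d (i+3) * F (u (i+3)) = 0"
    by (simp add: sum_cyclic_4[of _ i] F12)
  show "d (i + 3) < 0" if "0 < d i"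
    using mult_pos_pos[OF that F0] bal F3 by (smt (verit) mult_nonneg_nonneg)
  show "0 < d (i + 3)" if "d i < 0"
    using mult_neg_pos[OF that F0] bal F3 by (smt (verit) mult_nonpos_nonneg)
qed

text \<open>Stepping back by one index flips the sign, and three such steps from \<open>i\<close>
  reach every other index.\<close>

lemma affine_dependence_alternates:
  fixes u :: "4 \<Rightarrow> real^2" and d :: "4 \<Rightarrow> real" and i :: 4
  assumes "\<And>j. norm (u j) = 1"
    and "\<And>j. 0 < s * cross2 (u j) (u (j + 1))"
    and "(\<Sum>j\<in>UNIV. d j) = 0" and "(\<Sum>j\<in>UNIV. d j *\<^sub>R u j) = 0"
    and "0 < d i"
  shows "d (i + 1) < 0" and "d (i - 1) < 0" and "0 < d (i + 2)"
proof -
  note sign = affine_dependence_neighbour_sign[OF assms(1-4)]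
  have idx: "i - 1 = i + 3" "i + 3 + 3 = i + 2" "i + 2 + 3 = i + 1"
    using exhaust_4[of i] by auto
  show m: "d (i - 1) < 0"
    using sign(1)[of i] assms(5) by (simp only: idx)
  show p: "0 < d (i + 2)"
    using sign(2)[of "i + 3"] m by (simp only: idx)
  show "d (i + 1) < 0"
    using sign(1)[of "i + 2"] p by (simp only: idx)
qed

section \<open>Orientation of the projections as seen from \<open>P\<close>\<close>

text \<open>The positive relation makes \<open>P\<close> a convex combination of the vertices with
  positive coefficients, hence strictly inside every edge line. Adjacent cross products then agree
  in sign, and this propagates around the quadrilateral.\<close>

lemma convex_quadrilateral_cross2_same_sign:
  assumes quad: "convex_quadrilateral B"
    and pos: "\<And>j. 0 < l j" and comb0: "(\<Sum>j\<in>UNIV. l j *\<^sub>R (B j - P)) = 0"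
  shows "0 < cross2 (B i - P) (B (i + 1) - P) * cross2 (B j - P) (B (j + 1) - P)"
proof -
  have edge: "\<exists>n h. n \<bullet> (B j - P) = h \<and> n \<bullet> (B (j+1) - P) = h \<and>
      n \<bullet> (B (j+2) - P) < h \<and> n \<bullet> (B (j+3) - P) < h \<and> 0 < h" for j
  proof -
    obtain n c where n: "n \<bullet> B j = c" "n \<bullet> B (j+1) = c" "n \<bullet> B (j+2) < c" "n \<bullet> B (j+3) < c"
      using quad unfolding convex_quadrilateral_def by blast
    \<comment> \<open>The slack of \<open>P\<close> in the inequality of the edge; it is positive
      iff \<open>P\<close> is strictly on the inner side.\<close>
    define h where "h = c - n \<bullet> P"
    have e: "n \<bullet> (B j - P) = h" "n \<bullet> (B (j+1) - P) = h"
      "n \<bullet> (B (j+2) - P) < h" "n \<bullet> (B (j+3) - P) < h"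
      using n by (simp_all add: h_def inner_diff_right)
    have "0 = n \<bullet> (\<Sum>k\<in>UNIV. l k *\<^sub>R (B k - P))"
      by (simp add: comb0)
    also have "\<dots> = l j * h + l (j+1) * h + l (j+2) * (n \<bullet> (B (j+2) - P))
        + l (j+3) * (n \<bullet> (B (j+3) - P))"
      by (simp add: sum_cyclic_4[of _ j] inner_add_right e)
    also have "\<dots> < l j * h + l (j+1) * h + l (j+2) * h + l (j+3) * h"
      using e pos by (intro add_strict_mono add_strict_left_mono mult_strict_left_mono) auto
    also have "\<dots> = (l j + l (j+1) + l (j+2) + l (j+3)) * h"
      by (simp add: algebra_simps)
    finally have "0 < h"
      using pos by (meson add_pos_pos zero_less_mult_pos)
    with e show ?thesis
      by blast
  qed
  define c where "c j = cross2 (B j - P) (B (j + 1) - P)" for j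
  have step: "0 < c j * c (j + 1)" for j
  proof -
    have idx: "j + 1 + 1 = j + 2" "j + 1 + 2 = j + 3" "j + 1 + 3 = j"
      using exhaust_4[of j] by auto
    obtain n h where "n \<bullet> (B j - P) = h" "n \<bullet> (B (j+1) - P) = h" "n \<bullet> (B (j+2) - P) < h" "0 < h"
      using edge[of j] by blast
    moreover obtain m k where "m \<bullet> (B (j+1) - P) = k" "m \<bullet> (B (j+2) - P) = k"
      "m \<bullet> (B j - P) < k" "0 < k"
      using edge[of "j + 1"] unfolding idx by blast
    ultimately show ?thesis
      unfolding c_def idx by (rule cross2_consecutive_same_sign)
  qed
  have "j \<in> {i, i + 1, i + 2, i + 3}"
    using exhaust_4[of i] exhaust_4[of j] by auto
  moreover have "0 < c i * c (i + 1)" "0 < c (i + 1) * c (i + 2)" "0 < c (i + 2) * c (i + 3)"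
    using step[of i] step[of "i+1"] step[of "i+2"] by (simp_all add: add.assoc)
  ultimately have "0 < c i * c j"
    by (auto simp: zero_less_mult_iff)
  then show ?thesis
    by (simp add: c_def)
qed

section \<open>Closed curves, the octagon and the first-order condition\<close>

lemma closed_convex_curve_compact_nonempty:
  assumes "closed_convex_curve \<gamma>"
  shows "compact \<gamma>" and "\<gamma> \<noteq> {}"
  using assms
  by (auto simp: closed_convex_curve_def parametrizes_closed_curve_def
      intro: simple_path_imp_path)

text \<open>By the Jordan-Brouwer theorems the complement is disconnected, so some component lies
  inside, and the frontier of each component is the whole curve.\<close>

lemma closed_convex_curve_subset_closure_inside:
  assumes "closed_convex_curve \<gamma>"
  shows "\<gamma> \<subseteq> closure (inside \<gamma>)"
proof -
  obtain g where g: "simple_path g" "pathfinish g = pathstart g" "path_image g = \<gamma>"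
    using assms by (auto simp: closed_convex_curve_def parametrizes_closed_curve_def)
  have "\<gamma> homeomorphic sphere (0::complex) 1"
    using homeomorphic_simple_path_image_circle[OF g(1,2), of 1 0] g(3) by simp
  moreover have "sphere (0::complex) 1 homeomorphic sphere (0::real^2) 1"
    by (rule homeomorphic_spheres_gen) auto
  ultimately have hom: "\<gamma> homeomorphic sphere (0::real^2) 1"
    by (rule homeomorphic_trans)
  have "bounded \<gamma>"
    using g by (auto simp: bounded_simple_path_image)
  have "\<not> connected (- \<gamma>)"
    using hom by (rule Jordan_Brouwer_separation) simp
  moreover have "connected (outside \<gamma>)"
    using \<open>bounded \<gamma>\<close> by (intro connected_outside) auto
  ultimately have "inside \<gamma> \<noteq> {}"
    by (metis inside_Un_outside sup_bot_left)
  then obtain x where x: "x \<in> inside \<gamma>"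
    by blast
  define T where "T = connected_component_set (- \<gamma>) x"
  have "T \<in> components (- \<gamma>)"
    using x unfolding T_def inside_def by (intro componentsI) auto
  then have "frontier T = \<gamma>"
    using hom by (intro Jordan_Brouwer_frontier[of \<gamma> 0 1]) auto
  moreover have "T \<subseteq> inside \<gamma>"
    using inside_same_component[OF _ x] by (auto simp: T_def)
  ultimately show ?thesis
    using closure_mono[of T "inside \<gamma>"] by (auto simp: frontier_def)
qed

text \<open>The octagon omits only the open insides, so it may contain points of the curves; but
  near such a point there are always points of the inside.\<close>

lemma interior_octagon_not_on_curve:
  assumes "\<And>j. closed_convex_curve (\<gamma> j)" and "P \<in> interior (octagon A \<gamma>)"
  shows "P \<notin> \<gamma> j"
proof
  assume "P \<in> \<gamma> j"
  then have "P \<in> closure (inside (\<gamma> j))"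
    using closed_convex_curve_subset_closure_inside[OF assms(1)] by blast
  then have "interior (octagon A \<gamma>) \<inter> inside (\<gamma> j) \<noteq> {}"
    using assms(2) open_interior open_Int_closure_eq_empty by blast
  then show False
    using interior_subset by (fastforce simp: octagon_def)
qed

lemma fermat_torricelli_point_balance:
  assumes curves: "\<And>j. closed_convex_curve (\<gamma> j)"
    and P: "P \<in> interior (octagon A \<gamma>)"
    and pos: "\<And>j. 0 < w j" and FT: "fermat_torricelli_point A \<gamma> w P"
  shows "(\<Sum>j\<in>UNIV. w j *\<^sub>R sgn (closest_point (\<gamma> j) P - P)) = 0"
proof -
  define B where "B j = closest_point (\<gamma> j) P" for j
  have cl: "closed (\<gamma> j)" "\<gamma> j \<noteq> {}" for j
    using closed_convex_curve_compact_nonempty[OF curves] by (auto intro: compact_imp_closed)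
  have B: "B j \<in> \<gamma> j" "infdist P (\<gamma> j) = dist P (B j)" for j
    using cl by (simp_all add: B_def closest_point_in_set infdist_eq_setdist setdist_closest_point)
  \<comment> \<open>This makes each \<open>norm (X - B j)\<close> differentiable at
    \<open>P\<close>.\<close>
  have PB: "P - B j \<noteq> 0" for j
    using B(1) interior_octagon_not_on_curve[OF curves P] by (metis eq_iff_diff_eq_0)
  define g where "g X = (\<Sum>j\<in>UNIV. w j * norm (X - B j))" for X
  have min: "g P \<le> g X" if "X \<in> octagon A \<gamma>" for X
  proof -
    have "g P = (\<Sum>j\<in>UNIV. w j * infdist P (\<gamma> j))"
      by (simp add: g_def B dist_norm)
    also have "\<dots> \<le> (\<Sum>j\<in>UNIV. w j * infdist X (\<gamma> j))"
      using FT that unfolding fermat_torricelli_point_def is_arg_min_linorder by blast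
    also have "\<dots> \<le> g X"
      unfolding g_def dist_norm[symmetric]
      by (intro sum_mono mult_left_mono infdist_le B less_imp_le[OF pos])
    finally show ?thesis .
  qed
  define v where "v = (\<Sum>j\<in>UNIV. w j *\<^sub>R sgn (P - B j))"
  have "((\<lambda>X. X - B j) has_derivative (\<lambda>h. h)) (at P)" for j
    by (auto intro!: derivative_eq_intros)
  from has_derivative_compose[OF this has_derivative_norm[OF PB]]
  have "((\<lambda>X. norm (X - B j)) has_derivative (\<lambda>h. h \<bullet> sgn (P - B j))) (at P)" for j .
  then have "(g has_derivative (\<lambda>h. \<Sum>j\<in>UNIV. w j * (h \<bullet> sgn (P - B j)))) (at P)"
    unfolding g_def by (intro has_derivative_sum has_derivative_mult_right)
  then have "(g has_derivative (\<lambda>h. h \<bullet> v)) (at P)"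
    by (simp add: v_def inner_sum_right)
  \<comment> \<open>Minimality holds on an open set around \<open>P\<close>, so the derivative
    vanishes.\<close>
  then have "(\<lambda>h. h \<bullet> v) = (\<lambda>h. 0)"
    using P min interior_subset
    by (intro differential_zero_maxmin[of P "interior (octagon A \<gamma>)" g]) auto
  then have "v = 0"
    by (metis inner_eq_zero_iff)
  moreover have "sgn (P - B j) = - sgn (B j - P)" for j
    by (metis minus_diff_eq sgn_minus)
  ultimately show ?thesis
    by (simp add: v_def B_def sum_negf)
qed

theorem theorem4:
  fixes A :: "4 \<Rightarrow> real^2" and \<gamma> :: "4 \<Rightarrow> (real^2) set"
    and P :: "real^2" and w w' :: "4 \<Rightarrow> real" and i :: 4
  assumes "convex_quadrilateral A"
    and "\<And>j. closed_convex_curve (\<gamma> j)"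
    and "\<And>j. A j \<in> inside (\<gamma> j)"
    and "cuts_corners A \<gamma>"
    and "P \<in> interior (octagon A \<gamma>)"
    and "convex_quadrilateral (\<lambda>j. closest_point (\<gamma> j) P)"
    and "\<And>j. w j > 0" and "\<And>j. w' j > 0"
    and "(\<Sum>j\<in>UNIV. w j) = (\<Sum>j\<in>UNIV. w' j)"
    and "fermat_torricelli_point A \<gamma> w P"
    and "fermat_torricelli_point A \<gamma> w' P"
    and "w' i > w i"
  shows "w' (i + 1) < w (i + 1) \<and> w' (i - 1) < w (i - 1) \<and> w' (i + 2) > w (i + 2)"
proof -
  define B where "B j = closest_point (\<gamma> j) P" for j
  define u where "u j = sgn (B j - P)" for j
  define l where "l j = inverse (norm (B j - P))" for j
  have u_l: "u j = l j *\<^sub>R (B j - P)" for j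
    by (simp add: u_def l_def sgn_div_norm)
  have "B j \<noteq> P" for j
    using closest_point_in_set[of "\<gamma> j" P] interior_octagon_not_on_curve[OF assms(2,5)]
      closed_convex_curve_compact_nonempty[OF assms(2)]
    by (metis B_def compact_imp_closed)
  then have unit: "norm (u j) = 1" and l_pos: "0 < l j" for j
    by (simp_all add: u_def l_def norm_sgn)
  have bal: "(\<Sum>j\<in>UNIV. w j *\<^sub>R u j) = 0" "(\<Sum>j\<in>UNIV. w' j *\<^sub>R u j) = 0"
    using fermat_torricelli_point_balance[OF assms(2,5)] assms(7,8,10,11)
    by (simp_all add: u_def B_def)
  \<comment> \<open>The factors \<open>l j\<close> turn the balance of the unit vectors into a
    positive relation between the vectors \<open>B j - P\<close>.\<close>
  have same_sign: "0 < cross2 (B i - P) (B (i + 1) - P) * cross2 (B j - P) (B (j + 1) - P)" for j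
    by (rule convex_quadrilateral_cross2_same_sign[where l = "\<lambda>j. w j * l j"])
      (use assms(6,7) l_pos bal(1) in \<open>simp_all add: B_def[symmetric] u_l\<close>)
  \<comment> \<open>Only the sign of \<open>s\<close> matters: it records the orientation common to
    all four pairs of neighbours.\<close>
  define s where "s = cross2 (B i - P) (B (i + 1) - P)"
  have s: "0 < s * cross2 (u j) (u (j + 1))" for j
  proof -
    have "s * cross2 (u j) (u (j + 1)) = l j * l (j + 1) * (s * cross2 (B j - P) (B (j + 1) - P))"
      by (simp add: u_l cross2_scaleR)
    also have "\<dots> > 0"
      using same_sign l_pos by (simp add: s_def)
    finally show ?thesis .
  qed
  have "(\<Sum>j\<in>UNIV. w' j - w j) = 0" "(\<Sum>j\<in>UNIV. (w' j - w j) *\<^sub>R u j) = 0"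
    using assms(9) bal by (simp_all add: sum_subtractf scaleR_diff_left)
  from affine_dependence_alternates[OF unit s this, of i] assms(12) show ?thesis
    by simp
qed

end
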